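(* Let $G$ be a Legendrian $\theta$-graph in $(\mathbb{R}^3,\xi_{std})$ whose front projection is in standard form near its two vertices, and let $rot_1,rot_2,rot_3$ be the rotation numbers of its oriented cycles $\mathcal{C}_1,\mathcal{C}_2,\mathcal{C}_3$, labelled and oriented as in the context. Then $rot_1-rot_2+rot_3\in\{0,-1\}$.
   Context: $\xi_{std}=\ker(dz-y\,dx)$ on $\mathbb{R}^3$. A spatial graph is Legendrian if all its edges are Legendrian curves (tangent to $\xi_{std}$) that are non-tangent to each other at the vertices; more precisely, if all edges around a vertex are oriented outward, no two tangent vectors at the vertex coincide, but two may have the same direction with opposite orientations. A $\theta$-graph is a graph with two vertices and three edges, each joining the two vertices. The front projection is the projection to the $xz$-plane. Standard form near the vertices: the vertices are labelled $a$ and $b$; in the front projection, near $a$ all three edges lie to the right of $a$, and near $b$ all three edges lie to the left of $b$. Labelling: $e_1,e_2,e_3$ are the top, middle and lower strand at $a$ in the front projection. $\mathcal{C}_1$ is the oriented cycle exiting $a$ along $e_1$ and entering $a$ along $e_2$; $\mathcal{C}_2$ exits $a$ along $e_1$ and enters $a$ along $e_3$; $\mathcal{C}_3$ exits $a$ along $e_2$ and enters $a$ along $e_3$. The rotation number of a (piecewise smooth) oriented Legendrian cycle $\mathcal{C}$ is computed from its front projection by $rot(\mathcal{C})=\frac12(\downarrow\!\mathrm{cusps}(\mathcal{C})-\uparrow\!\mathrm{cusps}(\mathcal{C}))$, where $\downarrow\!\mathrm{cusps}$, $\uparrow\!\mathrm{cusps}$ are the numbers of cusps traversed downward and upward; a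 vertex at which the two edges of $\mathcal{C}$ lie on the same side (left or right) counts as a cusp. *)

theory Defs
  imports "HOL-Analysis.Analysis"
begin

text \<open>
  Points of three-space are written \<open>p\<close> with \<open>x = p $ 1\<close>, \<open>y = p $ 2\<close>, \<open>z = p $ 3\<close>;
  the front projection keeps \<open>p $ 1\<close> (horizontal) and \<open>p $ 3\<close> (vertical).
  Curves are paths parametrised by the unit interval, as in the library.
\<close>

definition xi_std :: "real ^ 3 \<Rightarrow> (real ^ 3) set" where
  "xi_std p = {v. v $ 3 - p $ 2 * v $ 1 = 0}"

definition velocity :: "(real \<Rightarrow> real ^ 3) \<Rightarrow> real \<Rightarrow> real ^ 3" where
  "velocity g t = vector_derivative g (at t within {0..1})"

text \<open>Derivatives at the end points of the unit interval are one-sided.\<close>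

definition smooth_path :: "(real \<Rightarrow> real ^ 3) \<Rightarrow> bool" where
  "smooth_path g \<longleftrightarrow>
     (\<exists>D :: nat \<Rightarrow> real \<Rightarrow> real ^ 3. D 0 = g \<and>
       (\<forall>n. \<forall>t\<in>{0..1}. (D n has_vector_derivative D (Suc n) t) (at t within {0..1})))"

definition legendrian_path :: "(real \<Rightarrow> real ^ 3) \<Rightarrow> bool" where
  "legendrian_path g \<longleftrightarrow> smooth_path g \<and>
     (\<forall>t\<in>{0..1}. velocity g t \<noteq> 0 \<and> velocity g t \<in> xi_std (g t))"

text \<open>
  Normalised tangent vector at the starting point, so that equality of two of these means
  equality of direction and orientation.
\<close>

definition initial_tangent :: "(real \<Rightarrow> real ^ 3) \<Rightarrow> real ^ 3" where
  "initial_tangent g = sgn (velocity g 0)"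

text \<open>
  The three edges \<open>e 1\<close>, \<open>e 2\<close>, \<open>e 3\<close> are all parametrised from \<open>a\<close> to \<open>b\<close>; hence at \<open>a\<close> they are
  oriented outward as they stand, and at \<open>b\<close> after reversal.
\<close>

definition legendrian_theta_graph ::
    "real ^ 3 \<Rightarrow> real ^ 3 \<Rightarrow> (nat \<Rightarrow> real \<Rightarrow> real ^ 3) \<Rightarrow> bool" where
  "legendrian_theta_graph a b e \<longleftrightarrow>
     a \<noteq> b \<and>
     (\<forall>i\<in>{1..3}. arc (e i) \<and> legendrian_path (e i) \<and>
        pathstart (e i) = a \<and> pathfinish (e i) = b) \<and>
     (\<forall>i\<in>{1..3}. \<forall>j\<in>{1..3}. i \<noteq> j \<longrightarrow>
        path_image (e i) \<inter> path_image (e j) = {a, b} \<and>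
        initial_tangent (e i) \<noteq> initial_tangent (e j) \<and>
        initial_tangent (reversepath (e i)) \<noteq> initial_tangent (reversepath (e j)))"

text \<open>
  Since \<open>dz = y dx\<close> along a Legendrian curve, its front is singular exactly where \<open>dx\<close> vanishes.
  Fronts are generic only in the sense needed for counting cusps: they have finitely many singular
  points.  This holds in particular if all singular points are semicubical cusps.
\<close>

definition finite_front_singularities :: "(real \<Rightarrow> real ^ 3) \<Rightarrow> bool" where
  "finite_front_singularities g \<longleftrightarrow> finite {t \<in> {0..1}. velocity g t $ 1 = 0}"

text \<open>
  A strand is a curve \<open>p\<close> leaving the point \<open>p 0\<close>; only its values at small positive parameters
  matter.  The relation \<open>above\<close> compares, in the front, two strands that leave the same point
  towards the same side.
\<close>

definition lies_right :: "(real \<Rightarrow> real ^ 3) \<Rightarrow> bool" where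
  "lies_right p \<longleftrightarrow> (\<forall>\<^sub>F s in at_right 0. p s $ 1 > p 0 $ 1)"

definition lies_left :: "(real \<Rightarrow> real ^ 3) \<Rightarrow> bool" where
  "lies_left p \<longleftrightarrow> (\<forall>\<^sub>F s in at_right 0. p s $ 1 < p 0 $ 1)"

definition above :: "(real \<Rightarrow> real ^ 3) \<Rightarrow> (real \<Rightarrow> real ^ 3) \<Rightarrow> bool" where
  "above p q \<longleftrightarrow>
     (\<exists>d>0. \<forall>s\<in>{0<..<d}. \<forall>t\<in>{0<..<d}. p s $ 1 = q t $ 1 \<longrightarrow> p s $ 3 > q t $ 3)"

definition standard_form :: "(nat \<Rightarrow> real \<Rightarrow> real ^ 3) \<Rightarrow> bool" where
  "standard_form e \<longleftrightarrow> (\<forall>i\<in>{1..3}. lies_right (e i) \<and> lies_left (reversepath (e i)))"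

definition top_middle_lower :: "(nat \<Rightarrow> real \<Rightarrow> real ^ 3) \<Rightarrow> bool" where
  "top_middle_lower e \<longleftrightarrow> above (e 1) (e 2) \<and> above (e 1) (e 3) \<and> above (e 2) (e 3)"

text \<open>
  For a closed path \<open>c\<close>, the two strands at the point with parameter \<open>t\<close>, both leaving that point;
  \<open>frac\<close> extends \<open>c\<close> periodically, so that the base point is treated like any other point.
\<close>

definition outgoing :: "(real \<Rightarrow> real ^ 3) \<Rightarrow> real \<Rightarrow> real \<Rightarrow> real ^ 3" where
  "outgoing c t s = c (frac (t + s))"

definition incoming :: "(real \<Rightarrow> real ^ 3) \<Rightarrow> real \<Rightarrow> real \<Rightarrow> real ^ 3" where
  "incoming c t s = c (frac (t - s))"

text \<open>
  A cusp is a point whose two strands lie on the same side of it in the front.  This covers both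
  cusps in the interior of an edge (there \<open>x\<close> has a local extremum, so the front is singular) and
  vertices at which the two edges of the cycle lie on the same side.
\<close>

definition is_cusp :: "(real \<Rightarrow> real ^ 3) \<Rightarrow> real \<Rightarrow> bool" where
  "is_cusp c t \<longleftrightarrow>
     (lies_right (incoming c t) \<and> lies_right (outgoing c t)) \<or>
     (lies_left (incoming c t) \<and> lies_left (outgoing c t))"

definition down_cusps :: "(real \<Rightarrow> real ^ 3) \<Rightarrow> real set" where
  "down_cusps c = {t \<in> {0..<1}. is_cusp c t \<and> above (incoming c t) (outgoing c t)}"

definition up_cusps :: "(real \<Rightarrow> real ^ 3) \<Rightarrow> real set" where
  "up_cusps c = {t \<in> {0..<1}. is_cusp c t \<and> above (outgoing c t) (incoming c t)}"

definition rot :: "(real \<Rightarrow> real ^ 3) \<Rightarrow> real" where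
  "rot c = (real (card (down_cusps c)) - real (card (up_cusps c))) / 2"

text \<open>The closed path that leaves \<open>a\<close> along \<open>e i\<close> and returns to \<open>a\<close> along \<open>e j\<close>.\<close>

definition theta_cycle :: "(nat \<Rightarrow> real \<Rightarrow> real ^ 3) \<Rightarrow> nat \<Rightarrow> nat \<Rightarrow> real \<Rightarrow> real ^ 3" where
  "theta_cycle e i j = e i +++ reversepath (e j)"

end

theory Submission
  imports Defs
begin

text \<open>
  Give every cusp of a closed front the sign \<open>+1\<close> if it is traversed downward and \<open>-1\<close> if it is
  traversed upward; then \<open>2 * rot\<close> is the sum of the signs.  The cusps of the cycle that leaves \<open>a\<close>
  along \<open>e i\<close> and returns along \<open>e j\<close> are those in the interior of \<open>e i\<close>, those in the interior of
  \<open>e j\<close>, and the two vertices.  If \<open>n i\<close> is the sum of the signs in the interior of \<open>e i\<close>, then the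
  interior cusps contribute \<open>n i - n j\<close>, because \<open>e j\<close> is traversed backward and reversal changes
  signs (\<open>rot_cycle\<close>).  In the alternating sum over the three cycles all interior contributions
  cancel, \<open>(n 1 - n 2) - (n 1 - n 3) + (n 2 - n 3) = 0\<close>, and only the vertices are left.

  At \<open>a\<close> each cycle arrives on a strand below the one on which it leaves, so that each vertex sign is
  \<open>-1\<close> and the alternating sum is \<open>-1\<close>.  At \<open>b\<close> the sign of the cycle is \<open>+1\<close> or \<open>-1\<close> according to
  whether the strand of \<open>e i\<close> lies above or below the strand of \<open>e j\<close>.  If the three strands at \<open>b\<close>
  are linearly ordered, then the signs \<open>s 1 2\<close>, \<open>s 1 3\<close>, \<open>s 2 3\<close> satisfy
  \<open>s 1 2 - s 1 3 + s 2 3 \<in> {1, -1}\<close>: the values \<open>3\<close> and \<open>-3\<close> would need a cyclic order.  Halving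
  \<open>-1 + 1\<close> or \<open>-1 - 1\<close> gives \<open>0\<close> or \<open>-1\<close>.

  The order at \<open>b\<close> is where the contact geometry enters.  Transitivity is the intermediate value
  theorem (\<open>above_trans_left\<close>).  Comparability (\<open>above_total_left\<close>) uses the tangent vectors: all lie
  in the plane \<open>xi_std b\<close> and in its half \<open>dx \<le> 0\<close>, so two different directions are separated by a
  line \<open>dy = m dx\<close> of that plane.  Since \<open>dz = y dx\<close>, the strands are then separated in the front by
  the parabola through \<open>b\<close> that has slope \<open>y b\<close> and second derivative \<open>m\<close>.
\<close>

section \<open>Strands near their starting point\<close>

definition same_side :: "(real \<Rightarrow> real ^ 3) \<Rightarrow> (real \<Rightarrow> real ^ 3) \<Rightarrow> bool" where
  "same_side p q \<longleftrightarrow> lies_right p \<and> lies_right q \<or> lies_left p \<and> lies_left q"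

definition turn :: "(real \<Rightarrow> real ^ 3) \<Rightarrow> (real \<Rightarrow> real ^ 3) \<Rightarrow> real" where
  "turn p q = of_bool (above p q) - of_bool (above q p)"

text \<open>
  The edges of a cycle are run through at double speed; the starting point \<open>s = 0\<close> is included because
  \<open>lies_right\<close> and \<open>lies_left\<close> refer to it.
\<close>

definition speeds_up :: "(real \<Rightarrow> real ^ 3) \<Rightarrow> (real \<Rightarrow> real ^ 3) \<Rightarrow> bool" where
  "speeds_up p' p \<longleftrightarrow> (\<exists>d>0. \<forall>s\<in>{0..<d}. p' s = p (2 * s))"

lemma turn_swap: "turn q p = - turn p q"
  by (simp add: turn_def)

lemma same_side_commute: "same_side p q \<longleftrightarrow> same_side q p"
  by (auto simp: same_side_def)

lemma eventually_near_0: "(\<forall>\<^sub>F s in at_right (0::real). P s) \<longleftrightarrow> (\<exists>d>0. \<forall>s\<in>{0<..<d}. P s)"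
  by (auto simp: eventually_at_right[of 0 1])

lemma near_0_rescale:
  "(\<exists>d>0. \<forall>s\<in>{0<..<d}. P (2 * s)) \<longleftrightarrow> (\<exists>d>0. \<forall>s\<in>{0<..<d::real}. P s)"
proof safe
  fix d :: real assume d: "d > 0" "\<forall>s\<in>{0<..<d}. P (2 * s)"
  have "P s" if "s \<in> {0<..<2 * d}" for s
    using d(2)[rule_format, of "s / 2"] that by simp
  then show "\<exists>d>0. \<forall>s\<in>{0<..<d}. P s"
    using d(1) by (intro exI[of _ "2 * d"]) auto
next
  fix d :: real assume "d > 0" "\<forall>s\<in>{0<..<d}. P s"
  then show "\<exists>d>0. \<forall>s\<in>{0<..<d}. P (2 * s)"
    by (intro exI[of _ "d / 2"]) auto
qed

lemma lies_speeds_up: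
  assumes "speeds_up p' p"
  shows "lies_right p' \<longleftrightarrow> lies_right p" "lies_left p' \<longleftrightarrow> lies_left p"
proof -
  obtain d where d: "d > 0" "\<And>s. s \<in> {0..<d} \<Longrightarrow> p' s = p (2 * s)"
    using assms by (auto simp: speeds_up_def)
  have eq: "\<forall>\<^sub>F s in at_right 0. p' s = p (2 * s)"
    unfolding eventually_near_0 using d by (intro exI[of _ d]) auto
  have p0: "p' 0 = p 0"
    using d by simp
  have "lies_right p' \<longleftrightarrow> (\<forall>\<^sub>F s in at_right 0. p (2 * s) $ 1 > p 0 $ 1)"
    unfolding lies_right_def p0 by (rule eventually_subst, rule eventually_mono[OF eq]) simp
  also have "\<dots> \<longleftrightarrow> lies_right p"
    unfolding lies_right_def eventually_near_0 by (rule near_0_rescale)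
  finally show "lies_right p' \<longleftrightarrow> lies_right p" .
  have "lies_left p' \<longleftrightarrow> (\<forall>\<^sub>F s in at_right 0. p (2 * s) $ 1 < p 0 $ 1)"
    unfolding lies_left_def p0 by (rule eventually_subst, rule eventually_mono[OF eq]) simp
  also have "\<dots> \<longleftrightarrow> lies_left p"
    unfolding lies_left_def eventually_near_0 by (rule near_0_rescale)
  finally show "lies_left p' \<longleftrightarrow> lies_left p" .
qed

lemma same_side_speeds_up:
  assumes "speeds_up p' p" "speeds_up q' q"
  shows "same_side p' q' \<longleftrightarrow> same_side p q"
  using assms by (simp add: same_side_def lies_speeds_up)

lemma above_speeds_up:
  assumes "speeds_up p' p" "speeds_up q' q"
  shows "above p' q' \<longleftrightarrow> above p q"
proof -
  obtain d1 d2 where d: "d1 > 0" "\<And>s. s \<in> {0..<d1} \<Longrightarrow> p' s = p (2 * s)"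
      "d2 > 0" "\<And>s. s \<in> {0..<d2} \<Longrightarrow> q' s = q (2 * s)"
    using assms by (auto simp: speeds_up_def)
  show ?thesis
  proof
    assume "above p' q'"
    then obtain d3 where d3: "d3 > 0"
      "\<And>s t. s \<in> {0<..<d3} \<Longrightarrow> t \<in> {0<..<d3} \<Longrightarrow> p' s $ 1 = q' t $ 1 \<Longrightarrow> p' s $ 3 > q' t $ 3"
      by (auto simp: above_def)
    define m where "m = min d1 (min d2 d3)"
    have "m > 0" using d d3 by (simp add: m_def)
    moreover have "p s $ 3 > q t $ 3"
      if "s \<in> {0<..<2*m}" "t \<in> {0<..<2*m}" "p s $ 1 = q t $ 1" for s t
      using d3(2)[of "s/2" "t/2"] d(2)[of "s/2"] d(4)[of "t/2"] that by (auto simp: m_def)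
    ultimately show "above p q"
      unfolding above_def by (intro exI[of _ "2 * m"]) auto
  next
    assume "above p q"
    then obtain d3 where d3: "d3 > 0"
      "\<And>s t. s \<in> {0<..<d3} \<Longrightarrow> t \<in> {0<..<d3} \<Longrightarrow> p s $ 1 = q t $ 1 \<Longrightarrow> p s $ 3 > q t $ 3"
      by (auto simp: above_def)
    define m where "m = min d1 (min d2 (d3/2))"
    have "m > 0" using d d3 by (simp add: m_def)
    moreover have "p' s $ 3 > q' t $ 3"
      if "s \<in> {0<..<m}" "t \<in> {0<..<m}" "p' s $ 1 = q' t $ 1" for s t
      using d3(2)[of "2 * s" "2 * t"] d(2)[of "s"] d(4)[of "t"] that by (auto simp: m_def)
    ultimately show "above p' q'"
      unfolding above_def by (intro exI[of _ m]) auto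
  qed
qed

lemma turn_speeds_up:
  assumes "speeds_up p' p" "speeds_up q' q"
  shows "turn p' q' = turn p q"
  using assms by (simp add: turn_def above_speeds_up)


section \<open>The order of strands at a vertex\<close>

lemma not_above_self: "\<not> above p p"
proof
  assume "above p p"
  then obtain d where "d > 0" and
    d: "\<And>s t. s \<in> {0<..<d} \<Longrightarrow> t \<in> {0<..<d} \<Longrightarrow> p s $ 1 = p t $ 1 \<Longrightarrow> p s $ 3 > p t $ 3"
    by (auto simp: above_def)
  then show False
    using d[of "d/2" "d/2"] by simp
qed

text \<open>
  Close to its starting point the curve \<open>q\<close> passes, by the intermediate value theorem, over every
  abscissa that \<open>p\<close> and \<open>r\<close> share, and so it can be inserted between the two.
\<close>

lemma above_trans_right:
  assumes cont: "continuous_on {0..1} p" "continuous_on {0..1} q" and start: "p 0 = q 0"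
    and lies: "lies_right p" "lies_right q" and above: "above p q" "above q r"
  shows "above p r"
proof -
  obtain d1 where d1: "d1 > 0"
      "\<And>s t. s \<in> {0<..<d1} \<Longrightarrow> t \<in> {0<..<d1} \<Longrightarrow> p s $ 1 = q t $ 1 \<Longrightarrow> p s $ 3 > q t $ 3"
    using above(1) by (auto simp: above_def)
  obtain d2 where d2: "d2 > 0"
      "\<And>s t. s \<in> {0<..<d2} \<Longrightarrow> t \<in> {0<..<d2} \<Longrightarrow> q s $ 1 = r t $ 1 \<Longrightarrow> q s $ 3 > r t $ 3"
    using above(2) by (auto simp: above_def)
  obtain d3 where d3: "d3 > 0" "\<And>s. s \<in> {0<..<d3} \<Longrightarrow> p s $ 1 > p 0 $ 1"
    using lies(1) by (auto simp: lies_right_def eventually_near_0)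
  obtain d4 where d4: "d4 > 0" "\<And>s. s \<in> {0<..<d4} \<Longrightarrow> q s $ 1 > q 0 $ 1"
    using lies(2) by (auto simp: lies_right_def eventually_near_0)
  \<comment> \<open>On \<open>{0..u}\<close> the curve \<open>q\<close> is comparable with both others; \<open>d5\<close> keeps \<open>p\<close> within the abscissas
    that this piece of \<open>q\<close> covers.\<close>
  define u where "u = min (min d1 d2) (min d4 1) / 2"
  have u: "0 < u" "u < d1" "u < d2" "u < d4" "u < 1"
    using d1(1) d2(1) d4(1) by (auto simp: u_def min_def)
  have "q u $ 1 > p 0 $ 1"
    using d4(2)[of u] u start by simp
  moreover have "continuous_on {0..1} (\<lambda>s. p s $ 1)"
    by (intro continuous_intros cont)
  ultimately obtain d5 where d5: "d5 > 0"
      "\<And>s. s \<in> {0..1} \<Longrightarrow> dist s 0 < d5 \<Longrightarrow> dist (p s $ 1) (p 0 $ 1) < q u $ 1 - p 0 $ 1"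
    unfolding continuous_on_iff by (metis atLeastAtMost_iff diff_gt_0_iff_gt order_refl zero_le_one)
  define d where "d = min (min d1 d2) (min d3 (min d5 1))"
  have "d > 0"
    using d1(1) d2(1) d3(1) d5(1) by (simp add: d_def)
  moreover have "p s $ 3 > r t $ 3"
    if st: "s \<in> {0<..<d}" "t \<in> {0<..<d}" and eq: "p s $ 1 = r t $ 1" for s t
  proof -
    have "p s $ 1 < q u $ 1"
      using d5(2)[of s] st(1) by (auto simp: d_def dist_real_def)
    moreover have ps: "q 0 $ 1 < p s $ 1"
      using d3(2)[of s] st(1) start by (auto simp: d_def)
    moreover have "continuous_on {0..u} (\<lambda>s. q s $ 1)"
      by (intro continuous_intros continuous_on_subset[OF cont(2)]) (use u in auto)
    ultimately obtain v where v: "0 \<le> v" "v \<le> u" "q v $ 1 = p s $ 1"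
      using IVT'[of "\<lambda>s. q s $ 1" 0 "p s $ 1" u] u by force
    have "v \<noteq> 0"
      using v(3) ps by auto
    then show ?thesis
      using d1(2)[of s v] d2(2)[of v t] v u st eq by (auto simp: d_def)
  qed
  ultimately show ?thesis
    unfolding above_def by blast
qed

text \<open>
  Reflecting the front in a vertical line exchanges left and right and preserves the relation \<open>above\<close>,
  so it carries transitivity from one side of a vertex to the other.
\<close>

definition mirror :: "(real \<Rightarrow> real ^ 3) \<Rightarrow> real \<Rightarrow> real ^ 3" where
  "mirror p s = (\<chi> k. if k = 1 then - p s $ 1 else p s $ k)"

lemma above_mirror: "above (mirror p) (mirror q) \<longleftrightarrow> above p q"
  by (simp add: above_def mirror_def)

lemma above_trans_left:
  assumes "continuous_on {0..1} p" "continuous_on {0..1} q" "p 0 = q 0"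
    and "lies_left p" "lies_left q" "above p q" "above q r"
  shows "above p r"
proof -
  have cont: "continuous_on {0..1} (mirror f)" if "continuous_on {0..1} f" for f
  proof -
    have "continuous_on {0..1} (\<lambda>s. if k = 1 then - f s $ 1 else f s $ k)" for k :: 3
      by (cases "k = 1") (auto intro!: continuous_intros that)
    then show ?thesis
      unfolding mirror_def by (intro continuous_on_vec_lambda)
  qed
  have "above (mirror p) (mirror r)"
    by (rule above_trans_right[of _ "mirror q"])
      (use assms in \<open>auto intro!: cont simp: above_mirror\<close>,
       auto simp: mirror_def lies_right_def lies_left_def)
  then show ?thesis
    by (simp add: above_mirror)
qed

section \<open>Velocities of Legendrian paths\<close>

lemma velocity_eqI:
  assumes "(g has_vector_derivative v) (at t within {0..1})" "t \<in> {0..1}"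
  shows "velocity g t = v"
  unfolding velocity_def
  by (rule vector_derivative_within_cbox[of 0 1 t, simplified, OF _ assms(1)]) (use assms in auto)

lemma legendrian_path_velocity:
  assumes "legendrian_path g"
  shows "continuous_on {0..1} (velocity g)"
    and "t \<in> {0..1} \<Longrightarrow> (g has_vector_derivative velocity g t) (at t within {0..1})"
    and "t \<in> {0..1} \<Longrightarrow> velocity g t \<noteq> 0"
    and "t \<in> {0..1} \<Longrightarrow> velocity g t $ 3 = g t $ 2 * velocity g t $ 1"
proof -
  obtain D where D: "D 0 = g"
    "\<And>n t. t \<in> {0..1} \<Longrightarrow> (D n has_vector_derivative D (Suc n) t) (at t within {0..1})"
    using assms unfolding legendrian_path_def smooth_path_def by blast
  have vel: "velocity g t = D 1 t" if "t \<in> {0..1}" for t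
    using D(1) D(2)[of t 0] that by (intro velocity_eqI) auto
  have "continuous_on {0..1} (D 1)"
    unfolding continuous_on_eq_continuous_within
    using D(2) has_vector_derivative_continuous by blast
  then show "continuous_on {0..1} (velocity g)"
    by (rule continuous_on_eq) (simp add: vel)
  show "t \<in> {0..1} \<Longrightarrow> (g has_vector_derivative velocity g t) (at t within {0..1})"
    using D(1) D(2)[of t 0] by (simp add: vel)
  show "t \<in> {0..1} \<Longrightarrow> velocity g t \<noteq> 0"
    "t \<in> {0..1} \<Longrightarrow> velocity g t $ 3 = g t $ 2 * velocity g t $ 1"
    using assms by (auto simp: legendrian_path_def xi_std_def)
qed

lemma has_vector_derivative_reversed:
  assumes "(f has_vector_derivative f') (at (1 - t) within {0..1})" "t \<in> {0..1::real}"
  shows "((\<lambda>s. f (1 - s)) has_vector_derivative - f') (at t within {0..1})"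
proof -
  have img: "(\<lambda>s. 1 - s) ` {0..1::real} = {0..1}"
    by (simp add: image_diff_atLeastAtMost)
  have "((\<lambda>s::real. 1 - s) has_vector_derivative - 1) (at t within {0..1})"
    by (auto intro!: derivative_eq_intros)
  from vector_diff_chain_within[OF this, of f f'] show ?thesis
    using assms by (simp add: img o_def)
qed

lemma velocity_reversepath:
  assumes "legendrian_path g" "t \<in> {0..1}"
  shows "velocity (reversepath g) t = - velocity g (1 - t)"
  using assms legendrian_path_velocity(2)[OF assms(1), of "1 - t"]
  by (intro velocity_eqI) (auto simp: reversepath_def intro!: has_vector_derivative_reversed)

lemma legendrian_path_reversepath:
  assumes "legendrian_path g"
  shows "legendrian_path (reversepath g)"
proof -
  obtain D where D: "D 0 = g"
    "\<And>n t. t \<in> {0..1} \<Longrightarrow> (D n has_vector_derivative D (Suc n) t) (at t within {0..1})"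
    using assms unfolding legendrian_path_def smooth_path_def by blast
  define E where "E n t = (-1) ^ n *\<^sub>R D n (1 - t)" for n and t :: real
  have "(E n has_vector_derivative E (Suc n) t) (at t within {0..1})" if "t \<in> {0..1}" for n t
  proof -
    have "((\<lambda>s. D n (1 - s)) has_vector_derivative - D (Suc n) (1 - t)) (at t within {0..1})"
      using D(2)[of "1 - t" n] that by (intro has_vector_derivative_reversed) auto
    from has_vector_derivative_scaleR[OF DERIV_const this, of "(-1) ^ n"] show ?thesis
      by (simp add: E_def[abs_def])
  qed
  moreover have "E 0 = reversepath g"
    by (simp add: E_def fun_eq_iff reversepath_def D(1))
  ultimately have "smooth_path (reversepath g)"
    unfolding smooth_path_def by blast
  moreover have "reversepath g t = g (1 - t)" for t
    by (simp add: reversepath_def)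
  ultimately show ?thesis
    using legendrian_path_velocity(3,4)[OF assms]
    by (simp add: legendrian_path_def velocity_reversepath[OF assms] xi_std_def)
qed

lemma finite_front_singularities_reversepath:
  assumes "legendrian_path g" "finite_front_singularities g"
  shows "finite_front_singularities (reversepath g)"
proof -
  have "{t \<in> {0..1}. velocity (reversepath g) t $ 1 = 0}
      = (\<lambda>t. 1 - t) ` {t \<in> {0..1}. velocity g t $ 1 = 0}"
    (is "?L = ?f ` ?R")
  proof (intro equalityI subsetI)
    fix t assume "t \<in> ?L"
    then show "t \<in> ?f ` ?R"
      using assms by (intro image_eqI[of _ _ "1 - t"]) (auto simp: velocity_reversepath)
  qed (use assms in \<open>auto simp: velocity_reversepath\<close>)
  then show ?thesis
    using assms(2) by (simp add: finite_front_singularities_def)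
qed

section \<open>Comparability of Legendrian strands\<close>

lemma component_derivatives:
  assumes "legendrian_path g" "t \<in> {0..1}"
  shows "((\<lambda>s. g s $ k) has_real_derivative velocity g t $ k) (at t within {0..1})"
  unfolding has_real_derivative_iff_has_vector_derivative
  by (intro bounded_linear.has_vector_derivative[OF bounded_linear_vec_nth]
      legendrian_path_velocity(2) assms)

lemma component_derivatives_at:
  assumes "legendrian_path g" "t \<in> {0<..<1}"
  shows "((\<lambda>s. g s $ k) has_real_derivative velocity g t $ k) (at t)"
  using component_derivatives[OF assms(1), of t k] assms(2)
  by (simp add: at_within_Icc_at)

lemma initial_velocity_left:
  assumes g: "legendrian_path g" and left: "lies_left g"
  shows "velocity g 0 $ 1 \<le> 0"
proof (rule ccontr)
  assume "\<not> velocity g 0 $ 1 \<le> 0"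
  then obtain d where d: "d > 0"
      "\<And>h. 0 < h \<Longrightarrow> 0 + h \<in> {0..1} \<Longrightarrow> h < d \<Longrightarrow> g 0 $ 1 < g (0 + h) $ 1"
    using has_real_derivative_pos_inc_right[OF component_derivatives[OF g, of 0 1]] by auto
  obtain d' where d': "d' > 0" "\<And>s. s \<in> {0<..<d'} \<Longrightarrow> g s $ 1 < g 0 $ 1"
    using left by (auto simp: lies_left_def eventually_near_0)
  define h where "h = min (min d d') 1 / 2"
  have "0 < h" "h < d" "h < d'" "h < 1"
    using d(1) d'(1) by (auto simp: h_def min_def)
  then show False
    using d(2)[of h] d'(2)[of h] by simp
qed

text \<open>
  The derivative of \<open>x\<close> is continuous and has no zero shortly after the start, hence a constant sign
  there; a positive sign would carry the strand to the right.
\<close>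

lemma leftward_strand_velocity:
  assumes g: "legendrian_path g" and fin: "finite_front_singularities g" and left: "lies_left g"
  obtains d where "0 < d" "d \<le> 1" "\<And>t. t \<in> {0<..<d} \<Longrightarrow> velocity g t $ 1 < 0"
proof -
  let ?Z = "{t \<in> {0..1}. velocity g t $ 1 = 0} - {0}"
  have "finite ?Z"
    using fin by (simp add: finite_front_singularities_def)
  then obtain d0 where d0: "d0 > 0" "\<forall>x\<in>?Z. x \<noteq> 0 \<longrightarrow> d0 \<le> dist 0 x"
    using finite_set_avoid[of ?Z 0] by auto
  obtain d' where d': "d' > 0" "\<And>s. s \<in> {0<..<d'} \<Longrightarrow> g s $ 1 < g 0 $ 1"
    using left by (auto simp: lies_left_def eventually_near_0)
  define d where "d = min (min d0 d') 1"
  have d: "0 < d" "d \<le> 1"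
    using d0(1) d'(1) by (auto simp: d_def)
  have nz: "velocity g t $ 1 \<noteq> 0" if "t \<in> {0<..<d}" for t
    using d0(2)[rule_format, of t] that by (auto simp: d_def)
  have "velocity g t $ 1 < 0" if t: "t \<in> {0<..<d}" for t
  proof (rule ccontr)
    assume "\<not> velocity g t $ 1 < 0"
    then have pos: "velocity g t $ 1 > 0"
      using nz[OF t] by linarith
    have cont: "continuous_on {s..t} (\<lambda>s. velocity g s $ 1)" if "0 < s" for s
      by (intro continuous_intros continuous_on_subset[OF legendrian_path_velocity(1)[OF g]])
        (use t d that in auto)
    have "velocity g s $ 1 > 0" if s: "0 < s" "s < t" for s
    proof (rule ccontr)
      assume "\<not> velocity g s $ 1 > 0"
      then obtain v where "s \<le> v" "v \<le> t" "velocity g v $ 1 = 0"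
        using IVT'[of "\<lambda>s. velocity g s $ 1" s 0 t] cont s pos by fastforce
      then show False
        using nz[of v] t s by auto
    qed
    then have "\<exists>y. DERIV (\<lambda>s. g s $ 1) s :> y \<and> y > 0" if "0 < s" "s < t" for s
      using component_derivatives_at[OF g, of s 1] that t d by auto
    moreover have "continuous_on {0..t} (\<lambda>s. g s $ 1)"
      by (rule continuous_on_subset[of "{0..1}"],
          rule DERIV_continuous_on[OF component_derivatives[OF g]]) (use t d in auto)
    ultimately have "g 0 $ 1 < g t $ 1"
      using t DERIV_pos_imp_increasing_open[of 0 t "\<lambda>s. g s $ 1"] by simp
    then show False
      using d'(2)[of t] t by (auto simp: d_def)
  qed
  then show thesis
    using that d by blast
qed

definition tangent_parabola :: "real ^ 3 \<Rightarrow> real \<Rightarrow> real \<Rightarrow> real" where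
  "tangent_parabola b m x = b $ 3 + b $ 2 * (x - b $ 1) + m / 2 * (x - b $ 1)\<^sup>2"

text \<open>
  Along a Legendrian curve with \<open>b = g 0\<close>, the relation \<open>dz = y dx\<close> shows that \<open>z\<close> minus the parabola
  has the derivative \<open>(y - y b - m * (x - x b)) * x'\<close>.  Shortly after the start, the first factor
  has the sign of its derivative at \<open>0\<close>, which is that of \<open>y' - m * x'\<close>, and \<open>x'\<close> is negative.  The
  factor \<open>\<sigma>\<close> is \<open>1\<close> or \<open>-1\<close> in the applications and treats both sides of the parabola at once.
\<close>

lemma strand_beside_parabola:
  assumes g: "legendrian_path g" and fin: "finite_front_singularities g" and left: "lies_left g"
    and \<sigma>: "\<sigma> * (velocity g 0 $ 2 - m * velocity g 0 $ 1) > 0"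
  obtains d where "0 < d"
    "\<And>s. s \<in> {0<..<d} \<Longrightarrow> \<sigma> * (g s $ 3 - tangent_parabola (g 0) m (g s $ 1)) < 0"
proof -
  obtain d1 where d1: "0 < d1" "d1 \<le> 1" "\<And>t. t \<in> {0<..<d1} \<Longrightarrow> velocity g t $ 1 < 0"
    using leftward_strand_velocity[OF g fin left] by metis
  \<comment> \<open>The derivative of \<open>F\<close> below is \<open>L\<close> times \<open>x'\<close>.\<close>
  define L where "L s = \<sigma> * (g s $ 2 - g 0 $ 2 - m * (g s $ 1 - g 0 $ 1))" for s
  have "(L has_real_derivative \<sigma> * (velocity g 0 $ 2 - m * velocity g 0 $ 1)) (at 0 within {0..1})"
    unfolding L_def by (auto intro!: derivative_eq_intros component_derivatives[OF g] simp: algebra_simps)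
  from has_real_derivative_pos_inc_right[OF this \<sigma>]
  obtain d2 where d2: "d2 > 0" "\<And>h. 0 < h \<Longrightarrow> h \<le> 1 \<Longrightarrow> h < d2 \<Longrightarrow> L h > 0"
    by (auto simp: L_def)
  define d where "d = min d1 d2"
  define F where "F s = \<sigma> * (g s $ 3 - tangent_parabola (g 0) m (g s $ 1))" for s
  have "F s < 0" if s: "s \<in> {0<..<d}" for s
  proof -
    have "DERIV F t :> L t * velocity g t $ 1" if t: "t \<in> {0<..<1}" for t
      unfolding F_def L_def tangent_parabola_def
      using legendrian_path_velocity(4)[OF g, of t] t
      by (auto intro!: derivative_eq_intros component_derivatives_at[OF g] simp: field_simps)
    moreover have "L t * velocity g t $ 1 < 0" if "0 < t" "t < s" for t
      using d1(2,3) d2(2)[of t] that s by (intro mult_pos_neg) (auto simp: d_def)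
    ultimately have "\<exists>y. DERIV F t :> y \<and> y < 0" if "0 < t" "t < s" for t
      using that s d1(2) by (intro exI[of _ "L t * velocity g t $ 1"]) (auto simp: d_def)
    moreover have "continuous_on {0..s} F"
    proof -
      have "continuous_on {0..1} g"
        unfolding continuous_on_eq_continuous_within
        using has_vector_derivative_continuous legendrian_path_velocity(2)[OF g] by blast
      then have "continuous_on {0..1} F"
        unfolding F_def tangent_parabola_def by (intro continuous_intros)
      then show ?thesis
        by (rule continuous_on_subset) (use s d1(2) in \<open>auto simp: d_def\<close>)
    qed
    ultimately have "F s < F 0"
      using s DERIV_neg_imp_decreasing_open[of 0 s F] by simp
    then show ?thesis
      by (simp add: F_def tangent_parabola_def)
  qed
  moreover have "d > 0"
    using d1(1) d2(1) by (simp add: d_def)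
  ultimately show thesis
    using that unfolding F_def by blast
qed

lemma above_if_separated:
  assumes g: "legendrian_path g" "finite_front_singularities g" "lies_left g"
    and h: "legendrian_path h" "finite_front_singularities h" "lies_left h"
    and start: "g 0 = h 0"
    and sep: "velocity g 0 $ 2 - m * velocity g 0 $ 1 < 0"
      "velocity h 0 $ 2 - m * velocity h 0 $ 1 > 0"
  shows "above g h"
proof -
  obtain d1 where d1: "0 < d1"
    "\<And>s. s \<in> {0<..<d1} \<Longrightarrow> -1 * (g s $ 3 - tangent_parabola (g 0) m (g s $ 1)) < 0"
    by (rule strand_beside_parabola[OF g, of "-1" m]) (use sep in auto)
  obtain d2 where d2: "0 < d2"
    "\<And>s. s \<in> {0<..<d2} \<Longrightarrow> 1 * (h s $ 3 - tangent_parabola (h 0) m (h s $ 1)) < 0"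
    by (rule strand_beside_parabola[OF h, of 1 m]) (use sep in auto)
  have "g s $ 3 > h t $ 3"
    if "s \<in> {0<..<min d1 d2}" "t \<in> {0<..<min d1 d2}" "g s $ 1 = h t $ 1" for s t
    using d1(2)[of s] d2(2)[of t] that start by auto
  then show ?thesis
    unfolding above_def using d1(1) d2(1) by (intro exI[of _ "min d1 d2"]) auto
qed

lemma sgn_eq_if_positive_multiple:
  fixes v w :: "'a::real_normed_vector"
  assumes "v = k *\<^sub>R w" "k > 0"
  shows "sgn v = sgn w"
  using assms by (simp add: sgn_scaleR)

text \<open>
  In the coordinates \<open>x\<close> and \<open>y\<close> of a contact plane, two different directions of the closed half-plane
  \<open>x \<le> 0\<close> are separated by a line that is not vertical.  If both are vertical, they are opposite and
  \<open>m = 0\<close> works; if one is vertical, \<open>m\<close> is the slope of the other one, changed by \<open>1\<close>; otherwise \<open>m\<close>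
  is the mean of the two slopes.
\<close>

lemma separating_slope:
  fixes v w :: "real ^ 3"
  assumes nz: "v \<noteq> 0" "w \<noteq> 0" and plane: "v $ 3 = y * v $ 1" "w $ 3 = y * w $ 1"
    and left: "v $ 1 \<le> 0" "w $ 1 \<le> 0" and ne: "sgn v \<noteq> sgn w"
  obtains m where "v $ 2 - m * v $ 1 < 0" "w $ 2 - m * w $ 1 > 0"
  | m where "w $ 2 - m * w $ 1 < 0" "v $ 2 - m * v $ 1 > 0"
proof -
  have nomult: "k \<le> 0" if "v $ 1 = k * w $ 1" "v $ 2 = k * w $ 2" for k
  proof (rule ccontr)
    assume "\<not> k \<le> 0"
    moreover have "v = k *\<^sub>R w"
      using that plane by (simp add: vec_eq_iff forall_3)
    ultimately show False
      using ne sgn_eq_if_positive_multiple[of v k w] by simp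
  qed
  have vert: "u $ 2 \<noteq> 0" if "u \<noteq> 0" "u $ 3 = y * u $ 1" "u $ 1 = 0" for u :: "real ^ 3"
    using that by (auto simp: vec_eq_iff forall_3)
  consider "v $ 1 = 0" "w $ 1 = 0" | "v $ 1 = 0" "w $ 1 < 0" | "v $ 1 < 0" "w $ 1 = 0"
    | "v $ 1 < 0" "w $ 1 < 0"
    using left by linarith
  then show thesis
  proof cases
    case 1
    have "v $ 2 \<noteq> 0" "w $ 2 \<noteq> 0"
      using 1 vert nz plane by auto
    moreover have "v $ 2 / w $ 2 \<le> 0"
      by (rule nomult) (use 1 \<open>w $ 2 \<noteq> 0\<close> in auto)
    ultimately show ?thesis
      using that[of 0] by (auto simp: divide_le_0_iff)
  next
    case 2
    then have "v $ 2 \<noteq> 0"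
      using vert nz plane by auto
    then show ?thesis
      using 2 that(1)[of "w $ 2 / w $ 1 + 1"] that(2)[of "w $ 2 / w $ 1 - 1"]
      by (cases "v $ 2 < 0") (auto simp: algebra_simps)
  next
    case 3
    then have "w $ 2 \<noteq> 0"
      using vert nz plane by auto
    then show ?thesis
      using 3 that(2)[of "v $ 2 / v $ 1 + 1"] that(1)[of "v $ 2 / v $ 1 - 1"]
      by (cases "w $ 2 < 0") (auto simp: algebra_simps)
  next
    case 4
    define \<mu> \<nu> where "\<mu> = v $ 2 / v $ 1" and "\<nu> = w $ 2 / w $ 1"
    define m where "m = (\<mu> + \<nu>) / 2"
    have eq: "v $ 2 = \<mu> * v $ 1" "w $ 2 = \<nu> * w $ 1"
      using 4 by (simp_all add: \<mu>_def \<nu>_def)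
    have "\<mu> \<noteq> \<nu>"
      using nomult[of "v $ 1 / w $ 1"] 4 eq by (auto simp: divide_le_0_iff)
    then consider "\<mu> > m" "\<nu> < m" | "\<nu> > m" "\<mu> < m"
      unfolding m_def by (cases "\<mu> < \<nu>") auto
    then show ?thesis
    proof cases
      case 1
      then have "(\<mu> - m) * v $ 1 < 0" "(\<nu> - m) * w $ 1 > 0"
        using 4 by (auto intro: mult_pos_neg mult_neg_neg)
      then show ?thesis
        using that(1)[of m] eq by (simp add: algebra_simps)
    next
      case 2
      then have "(\<mu> - m) * v $ 1 > 0" "(\<nu> - m) * w $ 1 < 0"
        using 4 by (auto intro: mult_pos_neg mult_neg_neg)
      then show ?thesis
        using that(2)[of m] eq by (simp add: algebra_simps)
    qed
  qed
qed

lemma above_total_left: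
  assumes g: "legendrian_path g" "finite_front_singularities g" "lies_left g"
    and h: "legendrian_path h" "finite_front_singularities h" "lies_left h"
    and start: "g 0 = h 0" and ne: "initial_tangent g \<noteq> initial_tangent h"
  shows "above g h \<or> above h g"
proof -
  have "velocity g 0 \<noteq> 0" "velocity h 0 \<noteq> 0"
    "velocity g 0 $ 3 = g 0 $ 2 * velocity g 0 $ 1" "velocity h 0 $ 3 = g 0 $ 2 * velocity h 0 $ 1"
    using legendrian_path_velocity(3,4)[OF g(1), of 0] legendrian_path_velocity(3,4)[OF h(1), of 0]
      start by auto
  then show ?thesis
  proof (rule separating_slope)
    show "velocity g 0 $ 1 \<le> 0" "velocity h 0 $ 1 \<le> 0"
      using g h initial_velocity_left by auto
    show "sgn (velocity g 0) \<noteq> sgn (velocity h 0)"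
      using ne by (simp add: initial_tangent_def)
  qed (use above_if_separated[OF g h start] above_if_separated[OF h g start[symmetric]] in blast)+
qed

section \<open>Counting the cusps of a cycle\<close>

definition backward :: "(real \<Rightarrow> real ^ 3) \<Rightarrow> real \<Rightarrow> real \<Rightarrow> real ^ 3" where
  "backward g u s = g (u - s)"

definition forward :: "(real \<Rightarrow> real ^ 3) \<Rightarrow> real \<Rightarrow> real \<Rightarrow> real ^ 3" where
  "forward g u s = g (u + s)"

definition interior_cusps :: "(real \<Rightarrow> real ^ 3) \<Rightarrow> real set" where
  "interior_cusps g = {u \<in> {0<..<1}. same_side (backward g u) (forward g u)}"

definition interior_turn :: "(real \<Rightarrow> real ^ 3) \<Rightarrow> real" where
  "interior_turn g = (\<Sum>u\<in>interior_cusps g. turn (backward g u) (forward g u))"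

text \<open>
  At an interior cusp the coordinate \<open>x\<close> has a local extremum, so the front is singular there.
\<close>

lemma finite_interior_cusps:
  assumes g: "legendrian_path g" and fin: "finite_front_singularities g"
  shows "finite (interior_cusps g)"
proof -
  have "velocity g u $ 1 = 0" if u: "u \<in> interior_cusps g" for u
  proof -
    have u01: "u \<in> {0<..<1}"
      using u by (simp add: interior_cusps_def)
    note der = component_derivatives_at[OF g u01, of 1]
    have near: "P v" if "\<bar>u - v\<bar> < d" and "P u" and "\<And>s. s \<in> {0<..<d} \<Longrightarrow> P (u - s)"
      and "\<And>s. s \<in> {0<..<d} \<Longrightarrow> P (u + s)" for P v d
      using that(1,2) that(3)[of "u - v"] that(4)[of "v - u"]
      by (cases u v rule: linorder_cases) auto
    consider "lies_right (backward g u)" "lies_right (forward g u)"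
      | "lies_left (backward g u)" "lies_left (forward g u)"
      using u by (auto simp: interior_cusps_def same_side_def)
    then show ?thesis
    proof cases
      case 1
      obtain d where d: "d > 0" "\<And>s. s \<in> {0<..<d} \<Longrightarrow> g (u - s) $ 1 > g u $ 1"
          "\<And>s. s \<in> {0<..<d} \<Longrightarrow> g (u + s) $ 1 > g u $ 1"
        using eventually_conj[OF 1[unfolded lies_right_def]]
        by (auto simp: backward_def forward_def eventually_near_0)
      have "g u $ 1 \<le> g v $ 1" if "\<bar>u - v\<bar> < d" for v
        using near[of v d "\<lambda>v. g u $ 1 \<le> g v $ 1"] that d(2,3) by (simp add: less_imp_le)
      then show ?thesis
        using DERIV_local_min[OF der d(1)] by blast
    next
      case 2
      obtain d where d: "d > 0" "\<And>s. s \<in> {0<..<d} \<Longrightarrow> g (u - s) $ 1 < g u $ 1"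
          "\<And>s. s \<in> {0<..<d} \<Longrightarrow> g (u + s) $ 1 < g u $ 1"
        using eventually_conj[OF 2[unfolded lies_left_def]]
        by (auto simp: backward_def forward_def eventually_near_0)
      have "g v $ 1 \<le> g u $ 1" if "\<bar>u - v\<bar> < d" for v
        using near[of v d "\<lambda>v. g v $ 1 \<le> g u $ 1"] that d(2,3) by (simp add: less_imp_le)
      then show ?thesis
        using DERIV_local_max[OF der d(1)] by blast
    qed
  qed
  then have "interior_cusps g \<subseteq> {t \<in> {0..1}. velocity g t $ 1 = 0}"
    by (auto simp: interior_cusps_def)
  then show ?thesis
    using fin by (auto simp: finite_front_singularities_def intro: finite_subset)
qed

lemma rot_eq_sum_turn:
  assumes "finite {t \<in> {0..<1}. is_cusp c t}"
  shows "2 * rot c = (\<Sum>t | t \<in> {0..<1} \<and> is_cusp c t. turn (incoming c t) (outgoing c t))"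
proof -
  let ?S = "{t \<in> {0..<1}. is_cusp c t}"
  have "down_cusps c = {t \<in> ?S. above (incoming c t) (outgoing c t)}"
    "up_cusps c = {t \<in> ?S. above (outgoing c t) (incoming c t)}"
    by (auto simp: down_cusps_def up_cusps_def)
  then show ?thesis
    using assms by (simp add: rot_def turn_def sum_subtractf sum_of_bool_eq Int_def conj_commute)
qed

lemma frac_near:
  fixes t s :: real
  shows "0 \<le> t + s \<Longrightarrow> t + s < 1 \<Longrightarrow> frac (t + s) = t + s"
    and "0 \<le> t - s \<Longrightarrow> t - s < 1 \<Longrightarrow> frac (t - s) = t - s"
    and "0 < s \<Longrightarrow> s \<le> 1 \<Longrightarrow> frac (- s) = 1 - s"
proof -
  show "0 \<le> t + s \<Longrightarrow> t + s < 1 \<Longrightarrow> frac (t + s) = t + s"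
    "0 \<le> t - s \<Longrightarrow> t - s < 1 \<Longrightarrow> frac (t - s) = t - s"
    by (simp_all add: frac_eq)
  show "0 < s \<Longrightarrow> s \<le> 1 \<Longrightarrow> frac (- s) = 1 - s"
    by (subst frac_unique_iff) auto
qed

text \<open>
  The parameters of the cycle are \<open>0\<close> at the first vertex, \<open>1/2\<close> at the second one, \<open>u/2\<close> at the
  point \<open>g u\<close>, and \<open>1 - u/2\<close> at the point \<open>h u\<close>.  On the second half \<open>h\<close> is run through backward,
  hence there \<open>forward h u\<close> is the incoming strand.
\<close>

lemma cycle_strands:
  fixes g h :: "real \<Rightarrow> real ^ 3"
  assumes start: "g 0 = h 0" and finish: "g 1 = h 1"
  defines "c \<equiv> g +++ reversepath h"
  shows "speeds_up (incoming c 0) h" "speeds_up (outgoing c 0) g"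
    and "speeds_up (incoming c (1/2)) (reversepath g)"
    and "speeds_up (outgoing c (1/2)) (reversepath h)"
    and "u \<in> {0<..<1} \<Longrightarrow> speeds_up (incoming c (u/2)) (backward g u)"
    and "u \<in> {0<..<1} \<Longrightarrow> speeds_up (outgoing c (u/2)) (forward g u)"
    and "u \<in> {0<..<1} \<Longrightarrow> speeds_up (incoming c (1 - u/2)) (forward h u)"
    and "u \<in> {0<..<1} \<Longrightarrow> speeds_up (outgoing c (1 - u/2)) (backward h u)"
proof -
  have c: "c t = (if t \<le> 1/2 then g (2 * t) else h (2 - 2 * t))" for t
    by (simp add: c_def joinpaths_def reversepath_def)
  \<comment> \<open>For \<open>s > 0\<close> the periodic extension evaluates \<open>c\<close> at \<open>1 - s\<close>, but for \<open>s = 0\<close> at \<open>0\<close>, which lies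
    on \<open>g\<close>.\<close>
  have "incoming c 0 s = h (2 * s)" if "s \<in> {0..<1/2}" for s
    using that start by (cases "s = 0") (auto simp: incoming_def frac_near c)
  then show "speeds_up (incoming c 0) h"
    unfolding speeds_up_def by (intro exI[of _ "1/2"]) auto
  have "outgoing c 0 s = g (2 * s)" if "s \<in> {0..<1/2}" for s
    using that frac_near(1)[of 0 s] by (auto simp: outgoing_def c)
  then show "speeds_up (outgoing c 0) g"
    unfolding speeds_up_def by (intro exI[of _ "1/2"]) auto
  have "incoming c (1/2) s = reversepath g (2 * s)" if "s \<in> {0..<1/2}" for s
    using that by (auto simp: incoming_def frac_near c reversepath_def algebra_simps)
  then show "speeds_up (incoming c (1/2)) (reversepath g)"
    unfolding speeds_up_def by (intro exI[of _ "1/2"]) auto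
  have "outgoing c (1/2) s = reversepath h (2 * s)" if "s \<in> {0..<1/2}" for s
    using that finish
    by (cases "s = 0") (auto simp: outgoing_def frac_near c reversepath_def algebra_simps)
  then show "speeds_up (outgoing c (1/2)) (reversepath h)"
    unfolding speeds_up_def by (intro exI[of _ "1/2"]) auto
  assume u: "u \<in> {0<..<1}"
  define d where "d = min (u/2) ((1 - u)/2)"
  have d: "d > 0" "d \<le> u/2" "d \<le> (1 - u)/2"
    using u by (auto simp: d_def min_def)
  have "incoming c (u/2) s = backward g u (2 * s)" if "s \<in> {0..<d}" for s
    using that u d by (auto simp: incoming_def frac_near c backward_def algebra_simps)
  then show "speeds_up (incoming c (u/2)) (backward g u)"
    unfolding speeds_up_def using d(1) by blast
  have "outgoing c (u/2) s = forward g u (2 * s)" if "s \<in> {0..<d}" for s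
    using that u d by (auto simp: outgoing_def frac_near c forward_def algebra_simps)
  then show "speeds_up (outgoing c (u/2)) (forward g u)"
    unfolding speeds_up_def using d(1) by blast
  have "incoming c (1 - u/2) s = forward h u (2 * s)" if "s \<in> {0..<d}" for s
    using that u d by (auto simp: incoming_def frac_near c forward_def algebra_simps)
  then show "speeds_up (incoming c (1 - u/2)) (forward h u)"
    unfolding speeds_up_def using d(1) by blast
  have "outgoing c (1 - u/2) s = backward h u (2 * s)" if "s \<in> {0..<d}" for s
    using that u d by (auto simp: outgoing_def frac_near c backward_def algebra_simps)
  then show "speeds_up (outgoing c (1 - u/2)) (backward h u)"
    unfolding speeds_up_def using d(1) by blast
qed

text \<open>
  The cusps are the two vertices and the interior cusps of both edges.  The interior cusps of \<open>h\<close> count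
  with the opposite sign because their incoming and outgoing strands are exchanged.
\<close>

lemma rot_cycle:
  fixes g h :: "real \<Rightarrow> real ^ 3"
  assumes start: "g 0 = h 0" and finish: "g 1 = h 1"
    and fin: "finite (interior_cusps g)" "finite (interior_cusps h)"
    and right: "lies_right g" "lies_right h"
    and left: "lies_left (reversepath g)" "lies_left (reversepath h)"
  shows "2 * rot (g +++ reversepath h) =
    turn h g + turn (reversepath g) (reversepath h) + interior_turn g - interior_turn h"
proof -
  define c where "c = g +++ reversepath h"
  define \<tau> where "\<tau> t = turn (incoming c t) (outgoing c t)" for t
  note strands = cycle_strands[OF start finish, folded c_def]
  have cusp: "is_cusp c t \<longleftrightarrow> same_side (incoming c t) (outgoing c t)" for t
    by (simp add: is_cusp_def same_side_def)
  have cusp0: "is_cusp c 0" and cusp1: "is_cusp c (1/2)"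
    unfolding cusp same_side_speeds_up[OF strands(1,2)] same_side_speeds_up[OF strands(3,4)]
    using right left by (simp_all add: same_side_def)
  have cusp_g: "is_cusp c (u/2) \<longleftrightarrow> u \<in> interior_cusps g" if "u \<in> {0<..<1}" for u
    unfolding cusp same_side_speeds_up[OF strands(5,6)[OF that]]
    using that by (simp add: interior_cusps_def)
  have cusp_h: "is_cusp c (1 - u/2) \<longleftrightarrow> u \<in> interior_cusps h" if "u \<in> {0<..<1}" for u
    unfolding cusp same_side_speeds_up[OF strands(7,8)[OF that]]
    using that by (simp add: interior_cusps_def same_side_commute)
  define A B where "A = (\<lambda>u. u/2) ` interior_cusps g" and "B = (\<lambda>u. 1 - u/2) ` interior_cusps h"
  have AB: "A \<subseteq> {0<..<1/2}" "B \<subseteq> {1/2<..<1}" "finite A" "finite B"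
    using fin by (auto simp: A_def B_def interior_cusps_def)
  have cusps: "{t. t \<in> {0..<1} \<and> is_cusp c t} = {0, 1/2} \<union> (A \<union> B)" (is "?C = ?D")
  proof (intro equalityI subsetI)
    fix t assume t: "t \<in> ?C"
    then consider "t = 0" | "t = 1/2" | "t \<in> {0<..<1/2}" | "t \<in> {1/2<..<1}"
      by force
    then show "t \<in> ?D"
    proof cases
      case 3
      then have "2 * t \<in> interior_cusps g"
        using cusp_g[of "2 * t"] t by auto
      then show ?thesis
        unfolding A_def by (auto intro!: image_eqI[of _ _ "2 * t"])
    next
      case 4
      then have "2 - 2 * t \<in> interior_cusps h"
        using cusp_h[of "2 - 2 * t"] t by (auto simp: field_simps)
      then show ?thesis
        unfolding B_def by (auto intro!: image_eqI[of _ _ "2 - 2 * t"] simp: field_simps)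
    qed auto
  next
    fix t assume "t \<in> ?D"
    then consider "t = 0" | "t = 1/2" | "t \<in> A" | "t \<in> B"
      by blast
    then show "t \<in> ?C"
    proof cases
      case 2
      show ?thesis
        unfolding 2 using cusp1 by simp
    qed (use cusp0 cusp_g cusp_h in \<open>auto simp: A_def B_def interior_cusps_def\<close>)
  qed
  have "2 * rot c = sum \<tau> ({0, 1/2} \<union> (A \<union> B))"
    using rot_eq_sum_turn[of c] AB(3,4) unfolding cusps \<tau>_def by simp
  also have "\<dots> = \<tau> 0 + \<tau> (1/2) + (sum \<tau> A + sum \<tau> B)"
  proof -
    have "{0, 1/2} \<inter> (A \<union> B) = {}" "A \<inter> B = {}"
      using AB(1,2) by fastforce+
    then show ?thesis
      using AB(3,4) by (simp add: sum.union_disjoint del: Un_insert_left)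
  qed
  also have "sum \<tau> A = interior_turn g"
  proof -
    have "sum \<tau> A = (\<Sum>u\<in>interior_cusps g. \<tau> (u/2))"
      unfolding A_def by (subst sum.reindex) (auto simp: inj_on_def)
    also have "\<dots> = interior_turn g"
      unfolding interior_turn_def \<tau>_def
      by (intro sum.cong refl turn_speeds_up strands(5,6)) (auto simp: interior_cusps_def)
    finally show ?thesis .
  qed
  also have "sum \<tau> B = - interior_turn h"
  proof -
    have "sum \<tau> B = (\<Sum>u\<in>interior_cusps h. \<tau> (1 - u/2))"
      unfolding B_def by (subst sum.reindex) (auto simp: inj_on_def)
    also have "\<dots> = (\<Sum>u\<in>interior_cusps h. turn (forward h u) (backward h u))"
      unfolding \<tau>_def
      by (intro sum.cong refl turn_speeds_up strands(7,8)) (auto simp: interior_cusps_def)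
    also have "\<dots> = - interior_turn h"
      unfolding interior_turn_def sum_negf[symmetric] by (intro sum.cong refl turn_swap)
    finally show ?thesis .
  qed
  also have "\<tau> 0 = turn h g"
    unfolding \<tau>_def by (rule turn_speeds_up[OF strands(1,2)])
  also have "\<tau> (1/2) = turn (reversepath g) (reversepath h)"
    unfolding \<tau>_def by (rule turn_speeds_up[OF strands(3,4)])
  finally show ?thesis
    by (simp add: c_def)
qed

section \<open>The three cycles of a \<open>\<theta>\<close>-graph\<close>

theorem lemma5:
  fixes a b :: "real ^ 3" and e :: "nat \<Rightarrow> real \<Rightarrow> real ^ 3"
  assumes "legendrian_theta_graph a b e"
    and "\<And>i. i \<in> {1..3} \<Longrightarrow> finite_front_singularities (e i)"
    and "standard_form e"
    and "top_middle_lower e"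
  shows "rot (theta_cycle e 1 2) - rot (theta_cycle e 1 3) + rot (theta_cycle e 2 3) \<in> {0, -1}"
proof -
  \<comment> \<open>The strands leaving \<open>b\<close>.\<close>
  define r where "r i = reversepath (e i)" for i
  have leg: "legendrian_path (e i)" and cont: "continuous_on {0..1} (e i)"
    and ends: "e i 0 = a" "e i 1 = b" if "i \<in> {1..3}" for i
    using assms(1) that
    by (auto simp: legendrian_theta_graph_def arc_def path_def pathstart_def pathfinish_def)
  have right: "lies_right (e i)" and left: "lies_left (r i)" if "i \<in> {1..3}" for i
    using assms(3) that by (auto simp: standard_form_def r_def)
  have contr: "continuous_on {0..1} (r i)" and startr: "r i 0 = b" if "i \<in> {1..3}" for i
    using cont[OF that] ends(2)[OF that] path_reversepath[of "e i"]
    by (auto simp: r_def path_def reversepath_def)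
  have tangents: "initial_tangent (r i) \<noteq> initial_tangent (r j)"
    if "i \<in> {1..3}" "j \<in> {1..3}" "i \<noteq> j" for i j
    using assms(1) that by (auto simp: legendrian_theta_graph_def r_def)
  have rot: "2 * rot (theta_cycle e i j) =
      -1 + turn (r i) (r j) + interior_turn (e i) - interior_turn (e j)"
    if ij: "i \<in> {1..3}" "j \<in> {1..3}" and above: "above (e i) (e j)" for i j
  proof -
    have "\<not> above (e j) (e i)"
      using above_trans_right[of "e i" "e j" "e i"] above not_above_self cont ends right ij by auto
    then have "turn (e j) (e i) = -1"
      using above by (simp add: turn_def)
    moreover have "finite (interior_cusps (e k))" if "k \<in> {1..3}" for k
      using finite_interior_cusps leg assms(2) that by blast
    ultimately show ?thesis
      unfolding theta_cycle_def
      using rot_cycle[of "e i" "e j"] ij ends right left by (simp add: r_def)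
  qed
  have trans: "above (r i) (r k)"
    if "above (r i) (r j)" "above (r j) (r k)" "i \<in> {1..3}" "j \<in> {1..3}" for i j k
    using above_trans_left[of "r i" "r j" "r k"] that contr startr left by auto
  have total: "above (r i) (r j) \<or> above (r j) (r i)"
    if "i \<in> {1..3}" "j \<in> {1..3}" "i \<noteq> j" for i j
    using that startr left tangents assms(2) leg unfolding r_def
    by (intro above_total_left legendrian_path_reversepath finite_front_singularities_reversepath)
      auto
  have turn: "turn (r i) (r j) = (if above (r i) (r j) then 1 else -1)"
    if "i \<in> {1..3}" "j \<in> {1..3}" "i \<noteq> j" for i j
    using total[OF that] trans[of i j i] that not_above_self by (auto simp: turn_def)
  have "turn (r 1) (r 2) - turn (r 1) (r 3) + turn (r 2) (r 3) \<in> {1, -1}"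
  proof -
    have "above (r 1) (r 3)" if "above (r 1) (r 2)" "above (r 2) (r 3)"
      using trans[of 1 2 3] that by simp
    moreover have "\<not> above (r 1) (r 3)" if "\<not> above (r 1) (r 2)" "\<not> above (r 2) (r 3)"
      using trans[of 1 3 2] total[of 2 3] that by auto
    ultimately show ?thesis
      using turn[of 1 2] turn[of 1 3] turn[of 2 3] by auto
  qed
  moreover have "above (e 1) (e 2)" "above (e 1) (e 3)" "above (e 2) (e 3)"
    using assms(4) by (auto simp: top_middle_lower_def)
  ultimately show ?thesis
    using rot[of 1 2] rot[of 1 3] rot[of 2 3] by auto
qed

end
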